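(* Let $S,P$ be disjoint finite sets, $\mathcal{V}_{SP}$ a regular vector space on $S\uplus P$, and set $\mathcal{V}_P:=\mathcal{V}_{SP}\times P$, $\mathcal{V}_S:=\mathcal{V}_{SP}\times S$. Let $\mathcal{K}_P$ be a generalized number lattice with $\mathcal{K}_P\subseteq\mathcal{V}_{SP}\circ P$ and $\mathcal{K}_P=\mathcal{V}_P+L_P$ where $L_P$ is a number lattice orthogonal to $\mathcal{V}_P$, and let $\mathcal{K}_S:=\mathcal{V}_{SP}\leftrightarrow\mathcal{K}_P$. Then: 1. $\mathcal{K}_S=\mathcal{V}_S+L_S$ for a number lattice $L_S$ orthogonal to $\mathcal{V}_S$; moreover $L_S\subseteq\mathcal{V}_{SP}\leftrightarrow L_P$ and $L_P\subseteq\mathcal{V}_{SP}\leftrightarrow L_S$. 2. For every $x_P\in L_P$, $x_P\ne0_P$, there is a unique $x_S\in L_S$ with $(x_S,x_P)\in\mathcal{V}_{SP}$; further $x_S\neq0_S$ and $\|x_S\|\le\sqrt{|S|\cdot|P|}\,\|x_P\|$. Symmetrically, for every $x_S\in L_S$, $x_S\ne0_S$, there is a unique $x_P\in L_P$ with $(x_S,x_P)\in\mathcal{V}_{SP}$; further $x_P\ne0_P$ and $\|x_P\|\le\sqrt{|S|\cdot|P|}\,\|x_S\|$. 3. Let $B_P$ be a basis matrix for $L_P$ with rows $x_{1P},\dots,x_{nP}$, let $x_{iS}$ be the unique vector in $L_S$ with $(x_{iS},x_{iP})\in\mathcal{V}_{SP}$, and let $B_S$ be the matrix with $i$-th row $x_{iS}$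 (a basis matrix for $L_S$). Let $B'_P,B''_S$ be obtained by permuting the rows of $B_P,B_S$ in order of increasing length, with rows $x'_{1P},\dots,x'_{nP}$ and $x''_{1S},\dots,x''_{nS}$. Then for each $i$, $\frac{1}{\sqrt{|S|\cdot|P|}}\|x'_{iP}\|\le\|x''_{iS}\|\le\sqrt{|S|\cdot|P|}\,\|x'_{iP}\|$. 4. Let $\hat B_P$ be an $\alpha$SM-basis matrix for $L_P$ with rows $\hat x_{1P},\dots,\hat x_{nP}$ satisfying $\|\hat x_{iP}\|\le\|\hat x_{jP}\|$ for $i\le j$, and let $\hat B_S$ be any basis matrix for $L_S$ with rows $\hat x_{1S},\dots,\hat x_{nS}$ satisfying $\|\hat x_{iS}\|\le\|\hat x_{jS}\|$ for $i\le j$. Then $\frac{1}{\alpha_i\sqrt{|S|\cdot|P|}}\|\hat x_{iP}\|\le\|\hat x_{iS}\|$ for each $i$. 5. Let $\hat B_P$ be an $\alpha$SM-basis matrix for $L_P$ with rows $\hat x_{1P},\dots,\hat x_{nP}$ satisfying $\|\hat x_{iP}\|\le\|\hat x_{jP}\|$ for $i\le j$, let $x_{iS}$ be the unique vector of $L_S$ with $(x_{iS},\hat x_{iP})\in\mathcal{V}_{SP}$, and let $B_S$ be the matrix with $i$-th row $x_{iS}$. Then $B_S$ is a $\beta$SM-basis matrix for $L_S$ where $\beta=(\alpha_1|S||P|,\dots,\alpha_n|S||P|)$.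
   Context: Vectors are over $\mathbb{Q}$; a vector on a finite set $X$ is a function $X\to\mathbb{Q}$, $0_X$ the zero vector, $(f_S,f_P)$ the vector on $S\uplus P$ formed from $f_S,f_P$, $\|\cdot\|$ the Euclidean norm. A number lattice is the set of integer linear combinations of finitely many vectors; a basis matrix has linearly independent rows generating it by integer combinations; a generalized number lattice is a sum of a number lattice and a vector space. Restriction $\mathcal{V}_{SP}\circ P=\{f_P:\exists f_S,(f_S,f_P)\in\mathcal{V}_{SP}\}$; contraction $\mathcal{V}_{SP}\times P=\{f_P:(0_S,f_P)\in\mathcal{V}_{SP}\}$ (similarly for $S$). Matched composition: $\mathcal{K}_{SP}\leftrightarrow\mathcal{K}_P=\{f_S:\exists h_P\in\mathcal{K}_P,(f_S,h_P)\in\mathcal{K}_{SP}\}$ and symmetrically with $S,P$ exchanged. A vector space is regular if it is spanned by the rows of a totally unimodular matrix (all square subdeterminants in $\{0,\pm1\}$). For a number lattice $L$ of rank $n$, the successive minima are $\lambda_i(L)=\inf\{r:\dim\mathrm{span}(L\cap\bar B(0,r))\ge i\}$, $i=1,\dots,n$. For $\alpha=(\alpha_1,\dots,\alpha_n)$, an $\alpha$SM-basis matrix of $L$ is a basis matrix whose $i$-th row has length at most $\alpha_i\lambda_i(L)$. *)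

theory Defs
  imports
    "HOL-Library.Function_Algebras"
    "HOL-Library.Set_Algebras"
    "HOL-Library.Multiset"
    "HOL-Analysis.L2_Norm"
    "Jordan_Normal_Form.Determinant"
begin

text \<open>
  A rational vector on a set \<open>X\<close> is encoded as a function on the ambient type that is zero
  outside \<open>X\<close>.  The zero vector on \<open>X\<close> is then the constant function \<open>0\<close>, and addition is pointwise.
\<close>

definition vecs_on :: "'a set \<Rightarrow> ('a \<Rightarrow> rat) set" where
  "vecs_on X = {f. \<forall>e. e \<notin> X \<longrightarrow> f e = 0}"

definition vscale :: "rat \<Rightarrow> ('a \<Rightarrow> rat) \<Rightarrow> 'a \<Rightarrow> rat" where
  "vscale c f = (\<lambda>e. c * f e)"

global_interpretation qv: Vector_Spaces.vector_space vscale
  by unfold_locales (auto simp: vscale_def fun_eq_iff algebra_simps)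

text \<open>
  For \<open>f\<close> on \<open>S\<close> and \<open>g\<close> on \<open>P\<close> with \<open>S\<close>, \<open>P\<close> disjoint, \<open>vjoin f g\<close> is the vector \<open>(f, g)\<close> on
  \<open>S \<union> P\<close>: because of the zero extension it is the pointwise sum.  It is commutative, so the
  operations below serve for both roles of \<open>S\<close> and \<open>P\<close>.
\<close>

definition vjoin :: "('a \<Rightarrow> rat) \<Rightarrow> ('a \<Rightarrow> rat) \<Rightarrow> 'a \<Rightarrow> rat" where
  "vjoin f g = (\<lambda>e. f e + g e)"

definition vdot :: "'a set \<Rightarrow> ('a \<Rightarrow> rat) \<Rightarrow> ('a \<Rightarrow> rat) \<Rightarrow> rat" where
  "vdot X f g = (\<Sum>e\<in>X. f e * g e)"

definition vnorm :: "'a set \<Rightarrow> ('a \<Rightarrow> rat) \<Rightarrow> real" where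
  "vnorm X f = L2_set (\<lambda>e. real_of_rat (f e)) X"

definition orthogonal_on :: "'a set \<Rightarrow> ('a \<Rightarrow> rat) set \<Rightarrow> ('a \<Rightarrow> rat) set \<Rightarrow> bool" where
  "orthogonal_on X A B \<longleftrightarrow> (\<forall>f\<in>A. \<forall>g\<in>B. vdot X f g = 0)"

definition vector_space_on :: "'a set \<Rightarrow> ('a \<Rightarrow> rat) set \<Rightarrow> bool" where
  "vector_space_on X V \<longleftrightarrow> V \<subseteq> vecs_on X \<and> qv.subspace V"

text \<open>
  Matrices with column set \<open>X\<close> are lists of rows, each row a vector on \<open>X\<close>.  A square submatrix is
  given by a list \<open>rs\<close> of distinct row indices and an equally long list \<open>cs\<close> of distinct columns;
  their order affects the determinant only by a sign.
\<close>

definition totally_unimodular :: "'a set \<Rightarrow> ('a \<Rightarrow> rat) list \<Rightarrow> bool" where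
  "totally_unimodular X A \<longleftrightarrow>
     (\<forall>rs cs. distinct rs \<and> set rs \<subseteq> {..<length A} \<and> distinct cs \<and> set cs \<subseteq> X \<and>
        length rs = length cs \<longrightarrow>
        Determinant.det (mat (length rs) (length cs) (\<lambda>(i, j). (A ! (rs ! i)) (cs ! j))) \<in> {0, 1, -1})"

definition regular_space :: "'a set \<Rightarrow> ('a \<Rightarrow> rat) set \<Rightarrow> bool" where
  "regular_space X V \<longleftrightarrow>
     (\<exists>A. set A \<subseteq> vecs_on X \<and> totally_unimodular X A \<and> V = qv.span (set A))"

definition int_span :: "('a \<Rightarrow> rat) list \<Rightarrow> ('a \<Rightarrow> rat) set" where
  "int_span B = {(\<Sum>i<length B. vscale (rat_of_int (c i)) (B ! i)) | c :: nat \<Rightarrow> int. True}"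

definition number_lattice :: "'a set \<Rightarrow> ('a \<Rightarrow> rat) set \<Rightarrow> bool" where
  "number_lattice X L \<longleftrightarrow> (\<exists>B. set B \<subseteq> vecs_on X \<and> L = int_span B)"

definition basis_matrix :: "('a \<Rightarrow> rat) set \<Rightarrow> ('a \<Rightarrow> rat) list \<Rightarrow> bool" where
  "basis_matrix L B \<longleftrightarrow> distinct B \<and> qv.independent (set B) \<and> int_span B = L"

definition generalized_number_lattice :: "'a set \<Rightarrow> ('a \<Rightarrow> rat) set \<Rightarrow> bool" where
  "generalized_number_lattice X K \<longleftrightarrow>
     (\<exists>L V. number_lattice X L \<and> vector_space_on X V \<and> K = L + V)"

text \<open>\<open>restriction V S P\<close> is \<open>V \<circ> P\<close> and \<open>contraction V P\<close> is \<open>V \<times> P\<close>, for \<open>V\<close> on \<open>S \<union> P\<close>.\<close>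

definition restriction :: "('a \<Rightarrow> rat) set \<Rightarrow> 'a set \<Rightarrow> 'a set \<Rightarrow> ('a \<Rightarrow> rat) set" where
  "restriction V S P = {f \<in> vecs_on P. \<exists>g \<in> vecs_on S. vjoin g f \<in> V}"

definition contraction :: "('a \<Rightarrow> rat) set \<Rightarrow> 'a set \<Rightarrow> ('a \<Rightarrow> rat) set" where
  "contraction V P = {f \<in> vecs_on P. vjoin 0 f \<in> V}"

text \<open>
  \<open>matched_comp V S K\<close> is \<open>V \<leftrightarrow> K\<close> for \<open>V\<close> on \<open>S \<union> P\<close> and \<open>K\<close> on \<open>P\<close>; the second argument is
  the index set of the result.
\<close>

definition matched_comp :: "('a \<Rightarrow> rat) set \<Rightarrow> 'a set \<Rightarrow> ('a \<Rightarrow> rat) set \<Rightarrow> ('a \<Rightarrow> rat) set" where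
  "matched_comp V S K = {f \<in> vecs_on S. \<exists>h\<in>K. vjoin f h \<in> V}"

definition succ_min :: "'a set \<Rightarrow> ('a \<Rightarrow> rat) set \<Rightarrow> nat \<Rightarrow> real" where
  "succ_min X L i = Inf {r :: real. qv.dim (qv.span (L \<inter> {f. vnorm X f \<le> r})) \<ge> i}"

text \<open>Successive minima are numbered from 1, list positions from 0.\<close>

definition SM_basis_matrix ::
  "'a set \<Rightarrow> real list \<Rightarrow> ('a \<Rightarrow> rat) set \<Rightarrow> ('a \<Rightarrow> rat) list \<Rightarrow> bool" where
  "SM_basis_matrix X \<alpha> L B \<longleftrightarrow>
     basis_matrix L B \<and> length \<alpha> = length B \<and>
     (\<forall>i<length B. vnorm X (B ! i) \<le> \<alpha> ! i * succ_min X L (Suc i))"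

definition length_ordered :: "'a set \<Rightarrow> ('a \<Rightarrow> rat) list \<Rightarrow> bool" where
  "length_ordered X B \<longleftrightarrow> sorted (map (vnorm X) B)"

definition partner :: "('a \<Rightarrow> rat) set \<Rightarrow> ('a \<Rightarrow> rat) set \<Rightarrow> ('a \<Rightarrow> rat) \<Rightarrow> 'a \<Rightarrow> rat" where
  "partner V L x = (THE y. y \<in> L \<and> vjoin y x \<in> V)"

end

theory Submission imports Defs "HOL-Analysis.Convex" begin

text \<open>
  A vector of \<open>LS\<close> is orthogonal to \<open>V \<times> S\<close>, so it is the shortest vector on \<open>S\<close> matching its partner
  \<open>y\<close> in \<open>LP\<close>. To bound it, pick columns \<open>Q \<subseteq> P\<close> of a maximal nonsingular minor within \<open>P\<close> of a totally
  unimodular matrix spanning \<open>V\<close>. Reducing to the identity on \<open>Q\<close> gives vectors \<open>r q \<in> V\<close> with entries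
  in \<open>{0, 1, -1}\<close>, and \<open>\<Sum>q\<in>Q. y q * r q\<close> agrees with \<open>y\<close> on \<open>P\<close>; by Cauchy-Schwarz each of its
  entries on \<open>S\<close> is at most \<open>sqrt (card P)\<close> times the norm of \<open>y\<close>. Matching is thus a bijection of the
  two lattices that preserves linear independence and distorts lengths in either direction by at
  most \<open>sqrt (card S * card P)\<close>, from which all statements about bases and successive minima follow.
\<close>

section \<open>Unimodular bases of regular spaces\<close>

lemma sum_fun_apply: "(\<Sum>i\<in>I. f i) e = (\<Sum>i\<in>I. f i e)"
  by (induction I rule: infinite_finite_induct) auto

text \<open>The kernel criterion is applied to the transpose. The coefficients form a plain
  function, so that the one belonging to an appended last row is easily split off.\<close>

lemma det_eq_0_iff_row_relation:
  fixes A :: "'b::field mat"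
  assumes A: "A \<in> carrier_mat n n"
  shows "Determinant.det A = 0 \<longleftrightarrow>
    (\<exists>z. (\<exists>i<n. z i \<noteq> 0) \<and> (\<forall>j<n. (\<Sum>i<n. z i * A $$ (i, j)) = 0))"
proof -
  have "(A\<^sup>T *\<^sub>v v = 0\<^sub>v n) \<longleftrightarrow> (\<forall>j<n. (\<Sum>i<n. v $ i * A $$ (i, j)) = 0)"
    if "v \<in> carrier_vec n" for v
    using A that
    by (auto simp: vec_eq_iff scalar_prod_def lessThan_atLeast0 mult.commute)
  moreover have "v = 0\<^sub>v n \<longleftrightarrow> (\<forall>i<n. v $ i = 0)" if "v \<in> carrier_vec n" for v :: "'b vec"
    using that by (auto simp: vec_eq_iff)
  ultimately have "Determinant.det A = 0 \<longleftrightarrow> (\<exists>v\<in>carrier_vec n.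
      (\<exists>i<n. v $ i \<noteq> 0) \<and> (\<forall>j<n. (\<Sum>i<n. v $ i * A $$ (i, j)) = 0))"
    using det_0_iff_vec_prod_zero[of "A\<^sup>T" n] A det_transpose[OF A]
    by (simp add: Bex_def cong: conj_cong)
  also have "\<dots> \<longleftrightarrow> (\<exists>z. (\<exists>i<n. z i \<noteq> 0) \<and> (\<forall>j<n. (\<Sum>i<n. z i * A $$ (i, j)) = 0))"
  proof
    assume "\<exists>z. (\<exists>i<n. z i \<noteq> 0) \<and> (\<forall>j<n. (\<Sum>i<n. z i * A $$ (i, j)) = 0)"
    then obtain z where z: "\<exists>i<n. z i \<noteq> 0" "\<forall>j<n. (\<Sum>i<n. z i * A $$ (i, j)) = 0"
      by blast
    then have "(\<exists>i<n. vec n z $ i \<noteq> 0) \<and> (\<forall>j<n. (\<Sum>i<n. vec n z $ i * A $$ (i, j)) = 0)"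
      by (auto simp: index_vec)
    then show "\<exists>v\<in>carrier_vec n.
      (\<exists>i<n. v $ i \<noteq> 0) \<and> (\<forall>j<n. (\<Sum>i<n. v $ i * A $$ (i, j)) = 0)"
      by (intro bexI[of _ "vec n z"]) auto
  qed blast
  finally show ?thesis .
qed

text \<open>
  The vectors \<open>r a\<close> are the rows of \<open>M\<^sup>-\<^sup>1 A\<close> for a maximal nonsingular submatrix \<open>M\<close> of \<open>A\<close>
  with columns in \<open>P\<close>; by Cramer's rule their entries are, up to sign, subdeterminants of \<open>A\<close>.
\<close>

lemma regular_space_unimodular_basis:
  assumes reg: "regular_space X V" and "finite P" "P \<subseteq> X"
  obtains cs r where "distinct cs" "set cs \<subseteq> P"
    "\<And>a. a < length cs \<Longrightarrow> r a \<in> V"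
    "\<And>a e. a < length cs \<Longrightarrow> r a e \<in> {0, 1, -1}"
    "\<And>x e. x \<in> V \<Longrightarrow> e \<in> P \<Longrightarrow> x e = (\<Sum>a<length cs. x (cs ! a) * r a e)"
proof -
  from reg obtain A where A: "set A \<subseteq> vecs_on X" and tu: "totally_unimodular X A"
    and V: "V = qv.span (set A)"
    unfolding regular_space_def by blast
  define minor where "minor rs cs = mat (length cs) (length cs) (\<lambda>(i, j). (A ! (rs ! i)) (cs ! j))"
    for rs :: "nat list" and cs :: "'a list"
  define good where "good p \<longleftrightarrow> (case p of (rs, cs) \<Rightarrow> distinct rs \<and> set rs \<subseteq> {..<length A} \<and>
      distinct cs \<and> set cs \<subseteq> P \<and> length rs = length cs \<and> Determinant.det (minor rs cs) \<noteq> 0)"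
    for p :: "nat list \<times> 'a list"
  \<comment> \<open>The empty minor has determinant 1, so the search for a largest nonsingular minor
    always has a starting point.\<close>
  have "good ([], [])"
    by (simp add: good_def minor_def)
  moreover have "\<forall>p. good p \<longrightarrow> length (snd p) < Suc (card P)"
    using \<open>finite P\<close> by (auto simp: good_def less_Suc_eq_le dest!: distinct_card)
      (metis card_mono)
  ultimately obtain p where "good p"
    and pmax: "\<forall>q. good q \<longrightarrow> length (snd q) \<le> length (snd p)"
    using ex_has_greatest_nat[of good "([], [])" "\<lambda>p. length (snd p)" "Suc (card P)"] by blast
  obtain rs cs where p: "p = (rs, cs)" by (cases p)
  define k where "k = length cs"
  define M where "M = minor rs cs"
  have good: "distinct rs" "set rs \<subseteq> {..<length A}" "distinct cs" "set cs \<subseteq> P" "length rs = k"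
    and detM: "Determinant.det M \<noteq> 0"
    using \<open>good p\<close> by (auto simp: good_def p k_def M_def)
  have M: "M \<in> carrier_mat k k"
    by (simp add: M_def minor_def k_def)
  have M_index: "M $$ (i, j) = (A ! (rs ! i)) (cs ! j)" if "i < k" "j < k" for i j
    using that by (simp add: M_def minor_def k_def)
  have unimod: "Determinant.det (minor rs' cs') \<in> {0, 1, -1}"
    if "distinct rs'" "set rs' \<subseteq> {..<length A}" "distinct cs'" "set cs' \<subseteq> X"
      "length rs' = length cs'" for rs' cs'
    using tu that unfolding totally_unimodular_def minor_def by auto
  have detM1: "Determinant.det M \<in> {1, -1}"
    using unimod[of rs cs] good \<open>P \<subseteq> X\<close> detM by (auto simp: M_def k_def)
  obtain N where N: "N \<in> carrier_mat k k" "M * N = 1\<^sub>m k" "N * M = 1\<^sub>m k"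
    using det_non_zero_imp_unit[OF M detM, of "()"] by (auto simp: Units_def ring_mat_def)
  define r where "r a = (\<Sum>i<k. vscale (N $$ (a, i)) (A ! (rs ! i)))" for a
  have r_apply: "r a e = (\<Sum>i<k. N $$ (a, i) * (A ! (rs ! i)) e)" for a e
    by (simp add: r_def sum_fun_apply vscale_def)
  have rs_in: "rs ! i < length A" if "i < k" for i
    using good that by (metis lessThan_iff nth_mem subsetD)
  have rV: "r a \<in> V" for a
    unfolding r_def V
    by (intro qv.span_sum qv.span_scale qv.span_base) (use rs_in in auto)
  have NM: "(\<Sum>i<k. N $$ (a, i) * M $$ (i, b)) = (if a = b then 1 else 0)"
    if "a < k" "b < k" for a b
  proof -
    have "(N * M) $$ (a, b) = (\<Sum>i<k. N $$ (a, i) * M $$ (i, b))"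
      using that M N(1) by (simp add: scalar_prod_def lessThan_atLeast0)
    then show ?thesis using N(3) that by simp
  qed
  have MN: "(\<Sum>i<k. M $$ (a, i) * N $$ (i, b)) = (if a = b then 1 else 0)"
    if "a < k" "b < k" for a b
  proof -
    have "(M * N) $$ (a, b) = (\<Sum>i<k. M $$ (a, i) * N $$ (i, b))"
      using that M N(1) by (simp add: scalar_prod_def lessThan_atLeast0)
    then show ?thesis using N(2) that by simp
  qed
  have r_cs: "r a (cs ! b) = (if a = b then 1 else 0)" if "a < k" "b < k" for a b
    using NM[OF that] that by (simp add: r_apply M_index)
  have row_rs: "(\<Sum>a<k. M $$ (i, a) * r a e) = (A ! (rs ! i)) e" if i: "i < k" for i e
  proof -
    have "(\<Sum>a<k. M $$ (i, a) * r a e)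
        = (\<Sum>a<k. \<Sum>j<k. M $$ (i, a) * N $$ (a, j) * (A ! (rs ! j)) e)"
      by (simp add: r_apply sum_distrib_left mult.assoc)
    also have "\<dots> = (\<Sum>j<k. (\<Sum>a<k. M $$ (i, a) * N $$ (a, j)) * (A ! (rs ! j)) e)"
      by (subst sum.swap) (simp add: sum_distrib_right)
    also have "\<dots> = (\<Sum>j<k. if i = j then (A ! (rs ! j)) e else 0)"
      by (intro sum.cong) (auto simp: MN i)
    finally show ?thesis using i by simp
  qed
  have entries: "r a e \<in> {0, 1, -1}" if a: "a < k" for a e
  proof (cases "e \<in> set cs")
    case True
    then obtain b where "b < k" "e = cs ! b" by (auto simp: in_set_conv_nth k_def)
    then show ?thesis using r_cs a by simp
  next
    case e: False
    show ?thesis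
    proof (cases "e \<in> X")
      case False
      have "(A ! (rs ! i)) e = 0" if "i < k" for i
        using subsetD[OF A nth_mem[OF rs_in[OF that]]] False by (simp add: vecs_on_def)
      then show ?thesis by (simp add: r_apply)
    next
      case True
      \<comment> \<open>\<open>M\<close> maps \<open>?u\<close> to column \<open>e\<close> of the
        chosen rows, so Cramer's rule gives \<open>r a e\<close> as a quotient of two minors:
        substituting that column for column \<open>a\<close> of \<open>M\<close> amounts to
        replacing \<open>cs ! a\<close> by \<open>e\<close>. Here \<open>e\<close> ranges over
        \<open>X\<close>, so entries outside \<open>P\<close> are covered as well.\<close>
      let ?u = "vec k (\<lambda>b. r b e)"
      have Mu: "M *\<^sub>v ?u = vec k (\<lambda>i. (A ! (rs ! i)) e)"
        using M by (auto simp: vec_eq_iff scalar_prod_def row_rs lessThan_atLeast0[symmetric])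
      have "replace_col M (M *\<^sub>v ?u) a = minor rs (cs[a := e])"
        using M a by (auto simp: replace_col_def Mu minor_def k_def[symmetric] M_index nth_list_update)
      moreover have "Determinant.det (replace_col M (M *\<^sub>v ?u) a) = r a e * Determinant.det M"
        using cramer_lemma_mat[OF M, of ?u a] a by simp
      moreover have "Determinant.det (minor rs (cs[a := e])) \<in> {0, 1, -1}"
        using good a e True \<open>P \<subseteq> X\<close> set_update_subset_insert[of cs a e]
        by (intro unimod distinct_list_update) (auto simp: k_def)
      ultimately show ?thesis using detM1 by auto
    qed
  qed
  have row: "(A ! j) e = (\<Sum>a<k. (A ! j) (cs ! a) * r a e)" if j: "j < length A" and e: "e \<in> P" for j e
  proof (cases "j \<in> set rs \<or> e \<in> set cs")
    case True
    then consider i where "i < k" "j = rs ! i" | b where "b < k" "e = cs ! b"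
      using good by (auto simp: in_set_conv_nth k_def)
    then show ?thesis
    proof cases
      case 1
      then show ?thesis using row_rs[of i e] by (simp add: M_index)
    next
      case 2
      have "(\<Sum>a<k. (A ! j) (cs ! a) * r a e) = (\<Sum>a<k. if a = b then (A ! j) (cs ! a) else 0)"
        by (intro sum.cong) (auto simp: 2 r_cs)
      then show ?thesis using 2 by simp
    qed
  next
    case False
    \<comment> \<open>By maximality the minor enlarged by row \<open>j\<close> and column
      \<open>e\<close> is singular. Its row relation \<open>z\<close> must involve row
      \<open>j\<close> because \<open>M\<close> is nonsingular; solving for that row gives the
      claim.\<close>
    have "\<not> good (rs @ [j], cs @ [e])"
      using pmax[rule_format, of "(rs @ [j], cs @ [e])"] by (auto simp: p)
    then have "Determinant.det (minor (rs @ [j]) (cs @ [e])) = 0"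
      using good False j e by (auto simp: good_def k_def)
    then obtain z where z0: "\<exists>i<Suc k. z i \<noteq> 0"
      and z: "\<forall>b<Suc k. (\<Sum>i<Suc k. z i * minor (rs @ [j]) (cs @ [e]) $$ (i, b)) = 0"
      using det_eq_0_iff_row_relation[of "minor (rs @ [j]) (cs @ [e])" "Suc k"]
      by (auto simp: minor_def k_def)
    have zb: "(\<Sum>i<k. z i * M $$ (i, b)) + z k * (A ! j) (cs ! b) = 0" if "b < k" for b
      using z[rule_format, of b] that good
      by (simp add: minor_def k_def[symmetric] nth_append M_index)
    have ze: "(\<Sum>i<k. z i * (A ! (rs ! i)) e) + z k * (A ! j) e = 0"
      using z[rule_format, of k] good
      by (simp add: minor_def nth_append k_def)
    have zk: "z k \<noteq> 0"
    proof
      assume "z k = 0"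
      then have "\<exists>i<k. z i \<noteq> 0" "\<forall>b<k. (\<Sum>i<k. z i * M $$ (i, b)) = 0"
        using z0 zb by (auto simp: less_Suc_eq)
      then show False using det_eq_0_iff_row_relation[OF M] detM by blast
    qed
    have zb': "z k * (A ! j) (cs ! b) = - (\<Sum>i<k. z i * M $$ (i, b))" if "b < k" for b
      using zb[OF that] by (simp add: eq_neg_iff_add_eq_0 add.commute)
    have "z k * (\<Sum>a<k. (A ! j) (cs ! a) * r a e) = (\<Sum>a<k. - (\<Sum>i<k. z i * M $$ (i, a)) * r a e)"
      unfolding sum_distrib_left
      by (intro sum.cong refl) (simp add: zb' flip: mult.assoc)
    also have "\<dots> = - (\<Sum>a<k. \<Sum>i<k. z i * (M $$ (i, a) * r a e))"
      by (simp add: sum_negf sum_distrib_right mult.assoc)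
    also have "\<dots> = - (\<Sum>i<k. z i * (A ! (rs ! i)) e)"
      by (subst sum.swap) (simp add: row_rs flip: sum_distrib_left)
    also have "\<dots> = z k * (A ! j) e"
      using ze by simp
    finally show ?thesis using zk by simp
  qed
  have "x e = (\<Sum>a<k. x (cs ! a) * r a e)" if x: "x \<in> V" and e: "e \<in> P" for x e
    using x unfolding V
  proof (induction rule: qv.span_induct_alt)
    case base
    then show ?case by simp
  next
    case (step c x y)
    then obtain j where "j < length A" "x = A ! j" by (auto simp: in_set_conv_nth)
    then show ?case
      using step row[OF _ e, of j]
      by (simp add: vscale_def algebra_simps sum.distrib sum_distrib_left)
  qed
  with that[of cs r] good rV entries show ?thesis by (auto simp: k_def)
qed

section \<open>Rational vectors and number lattices\<close>

lemma vjoin_eq_plus: "vjoin f g = f + g"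
  by (simp add: vjoin_def fun_eq_iff)

lemma subspace_vecs_on: "qv.subspace (vecs_on X)"
  by (auto simp: qv.subspace_def vecs_on_def vscale_def)

lemma vdot_add_left: "vdot X (f + g) h = vdot X f h + vdot X g h"
  by (simp add: vdot_def algebra_simps sum.distrib)

lemma vdot_scale_left: "vdot X (vscale c f) h = c * vdot X f h"
  by (simp add: vdot_def vscale_def algebra_simps sum_distrib_left)

lemma vdot_commute: "vdot X f g = vdot X g f"
  by (simp add: vdot_def mult.commute)

lemma vdot_diff_left: "vdot X (f - g) h = vdot X f h - vdot X g h"
  by (simp add: vdot_def algebra_simps sum_subtractf)

lemma vdot_sum_left: "vdot X (\<Sum>i\<in>I. f i) h = (\<Sum>i\<in>I. vdot X (f i) h)"
  by (simp add: vdot_def sum_fun_apply sum_distrib_right) (rule sum.swap)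

lemma vdot_self_nonneg: "0 \<le> vdot X f f"
  by (simp add: vdot_def sum_nonneg)

lemma vdot_self_eq_0_iff:
  assumes "finite X" "f \<in> vecs_on X"
  shows "vdot X f f = 0 \<longleftrightarrow> f = 0"
  using assms by (auto simp: vdot_def vecs_on_def sum_nonneg_eq_0_iff fun_eq_iff)

lemma vnorm_eq: "vnorm X f = sqrt (real_of_rat (vdot X f f))"
  by (simp add: vnorm_def L2_set_def vdot_def of_rat_sum of_rat_mult power2_eq_square)

lemma vnorm_nonneg: "0 \<le> vnorm X f"
  by (simp add: vnorm_eq vdot_self_nonneg)

lemma vnorm_eq_0_iff:
  assumes "finite X" "f \<in> vecs_on X"
  shows "vnorm X f = 0 \<longleftrightarrow> f = 0"
  using vdot_self_eq_0_iff[OF assms] by (simp add: vnorm_eq)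

lemma subspace_orthogonal: "qv.subspace {f. \<forall>g\<in>A. vdot X f g = 0}"
  by (auto simp: qv.subspace_def vdot_add_left vdot_scale_left) (simp add: vdot_def)

lemma vdot_span_eq_0:
  assumes "\<forall>b\<in>B. vdot X f b = 0" "c \<in> qv.span B"
  shows "vdot X f c = 0"
  using qv.span_minimal[OF _ subspace_orthogonal[of "{f}" X], of B] assms
  by (auto simp: vdot_commute)

lemma vecs_on_subset_span:
  assumes "finite X"
  shows "vecs_on X \<subseteq> qv.span ((\<lambda>e. (\<lambda>d. if d = e then 1 else 0)) ` X)"
proof
  fix f :: "'a \<Rightarrow> rat" assume f: "f \<in> vecs_on X"
  have "f = (\<Sum>e\<in>X. vscale (f e) (\<lambda>d. if d = e then 1 else 0))"
    using f assms
    by (auto simp: fun_eq_iff sum_fun_apply vscale_def vecs_on_def if_distrib cong: if_cong)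
  also have "\<dots> \<in> qv.span ((\<lambda>e. (\<lambda>d. if d = e then 1 else 0)) ` X)"
    by (intro qv.span_sum qv.span_scale qv.span_base) auto
  finally show "f \<in> qv.span ((\<lambda>e. (\<lambda>d. if d = e then 1 else 0)) ` X)" .
qed

lemma finite_independent_vecs_on:
  assumes "finite X" "qv.independent B" "B \<subseteq> vecs_on X"
  shows "finite B"
  using qv.independent_span_bound[OF _ assms(2)] vecs_on_subset_span[OF assms(1)] assms
  by (meson finite_imageI subset_trans)

text \<open>The ambient function space may be infinite-dimensional; the finite basis against which
  cardinalities are compared comes from the finite support set \<open>X\<close>.\<close>

lemma card_independent_le_dim:
  assumes "finite X" "A \<subseteq> vecs_on X" "B \<subseteq> A" "qv.independent B"
  shows "card B \<le> qv.dim A"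
proof -
  obtain C where C: "B \<subseteq> C" "C \<subseteq> A" "qv.independent C" "A \<subseteq> qv.span C"
    using qv.maximal_independent_subset_extend[OF assms(3,4)] by blast
  have "finite C"
    using C assms by (meson finite_independent_vecs_on subset_trans)
  with C show ?thesis
    using card_mono[of C B] qv.basis_card_eq_dim[of C A] by simp
qed

section \<open>Orthogonal projection over the rationals\<close>

text \<open>Gram-Schmidt without normalisation: the only divisor is \<open>vdot X f f\<close> for a
  nonzero vector \<open>f\<close>, so no square root occurs and the projection stays
  rational.\<close>

lemma orthogonal_projection_span:
  assumes X: "finite X" and "finite B" "B \<subseteq> vecs_on X" "y \<in> vecs_on X"
  shows "\<exists>w \<in> qv.span B. \<forall>b\<in>B. vdot X (y - w) b = 0"
  using assms(2-)
proof (induction B arbitrary: y rule: finite_induct)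
  case empty
  then show ?case by (auto intro: qv.span_zero)
next
  case (insert b B)
  \<comment> \<open>The new generator is itself projected, and \<open>b - u\<close> is its part
    orthogonal to the old generators.\<close>
  obtain u where u: "u \<in> qv.span B" "\<forall>c\<in>B. vdot X (b - u) c = 0"
    using insert.IH[of b] insert.prems by (metis insert_subset)
  obtain v where v: "v \<in> qv.span B" "\<forall>c\<in>B. vdot X (y - v) c = 0"
    using insert.IH[of y] insert.prems by (metis insert_subset)
  have sub: "qv.span B \<subseteq> qv.span (insert b B)"
    by (intro qv.span_mono) auto
  show ?case
  proof (cases "b - u = 0")
    case True
    then have "b \<in> qv.span B" using u by simp
    then have "\<forall>c\<in>insert b B. vdot X (y - v) c = 0"
      using vdot_span_eq_0[OF v(2)] v(2) by blast
    then show ?thesis using v sub by blast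
  next
    case False
    have "u \<in> vecs_on X"
      using u(1) qv.span_minimal[OF _ subspace_vecs_on, of B X] insert.prems by auto
    then have "b - u \<in> vecs_on X"
      using insert.prems by (intro qv.subspace_diff[OF subspace_vecs_on]) auto
    then have bu: "vdot X (b - u) (b - u) \<noteq> 0"
      using False vdot_self_eq_0_iff[OF X] by blast
    define t where "t = vdot X (y - v) (b - u) / vdot X (b - u) (b - u)"
    define w where "w = v + vscale t (b - u)"
    have split: "vdot X (y - w) c = vdot X (y - v) c - t * vdot X (b - u) c" for c
      by (simp add: w_def diff_diff_add[symmetric] vdot_diff_left[of _ "y - v"] vdot_scale_left)
    have wB: "\<forall>c\<in>B. vdot X (y - w) c = 0"
      using split u v by simp
    have "vdot X (y - w) (b - u) = 0"
      using split[of "b - u"] bu by (simp add: t_def)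
    moreover have "vdot X (y - w) u = 0"
      using vdot_span_eq_0[OF wB u(1)] .
    ultimately have "vdot X (y - w) b = 0"
      using vdot_diff_left[of X b u "y - w"] by (simp add: vdot_commute)
    moreover have "w \<in> qv.span (insert b B)"
      unfolding w_def using subsetD[OF sub u(1)] subsetD[OF sub v(1)] qv.span_base[of b "insert b B"]
      by (intro qv.span_add qv.span_scale qv.span_diff) auto
    ultimately show ?thesis using wB by blast
  qed
qed

lemma orthogonal_projection:
  assumes X: "finite X" and W: "vector_space_on X W" and y: "y \<in> vecs_on X"
  obtains w where "w \<in> W" "\<forall>b\<in>W. vdot X (y - w) b = 0"
proof -
  obtain B where B: "B \<subseteq> W" "qv.independent B" "W \<subseteq> qv.span B"
    using qv.maximal_independent_subset by blast
  have "B \<subseteq> vecs_on X" using B W by (auto simp: vector_space_on_def)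
  moreover have "finite B" using calculation B X by (meson finite_independent_vecs_on)
  ultimately obtain w where w: "w \<in> qv.span B" "\<forall>b\<in>B. vdot X (y - w) b = 0"
    using orthogonal_projection_span[OF X _ _ y] by blast
  have "vdot X (y - w) c = 0" if "c \<in> qv.span B" for c
    using vdot_span_eq_0[OF w(2) that] .
  moreover have "qv.span B \<subseteq> W"
    using B W by (intro qv.span_minimal) (auto simp: vector_space_on_def)
  ultimately show ?thesis using that w B by blast
qed

section \<open>Number lattices as integer spans\<close>

lemma int_spanI: "x = (\<Sum>i<length B. vscale (rat_of_int (c i)) (B ! i)) \<Longrightarrow> x \<in> int_span B"
  by (auto simp: int_span_def)

text \<open>Closure under differences and membership of zero both follow from this form. It reduces
  to closure under adding an integer multiple, where coefficients with respect to the generators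
  combine.\<close>

lemma number_lattice_sum:
  assumes "number_lattice X L" "\<And>i. i \<in> I \<Longrightarrow> f i \<in> L"
  shows "(\<Sum>i\<in>I. vscale (rat_of_int (c i)) (f i)) \<in> L"
proof -
  obtain B where L: "L = int_span B"
    using assms(1) by (auto simp: number_lattice_def)
  have zero: "0 \<in> L"
    unfolding L by (rule int_spanI[where c = "\<lambda>_. 0"]) simp
  have add: "vscale (rat_of_int m) x + y \<in> L" if xy: "x \<in> L" "y \<in> L" for x y m
  proof -
    obtain a b where "x = (\<Sum>i<length B. vscale (rat_of_int (a i)) (B ! i))"
      "y = (\<Sum>i<length B. vscale (rat_of_int (b i)) (B ! i))"
      using xy by (auto simp: L int_span_def)
    then have "vscale (rat_of_int m) x + y
        = (\<Sum>i<length B. vscale (rat_of_int (m * a i + b i)) (B ! i))"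
      by (simp add: qv.scale_sum_right qv.scale_left_distrib sum.distrib)
    then show ?thesis unfolding L by (rule int_spanI)
  qed
  show ?thesis
    using assms(2) by (induction I rule: infinite_finite_induct) (auto simp: zero add)
qed

lemma number_lattice_diff:
  assumes "number_lattice X L" "x \<in> L" "y \<in> L"
  shows "x - y \<in> L"
proof -
  have "(\<Sum>i\<in>{True, False}. vscale (rat_of_int (if i then 1 else -1)) (if i then x else y)) \<in> L"
    by (intro number_lattice_sum[OF assms(1)]) (use assms in auto)
  then show ?thesis by simp
qed

lemma number_lattice_zero:
  assumes "number_lattice X L"
  shows "0 \<in> L"
  using number_lattice_sum[OF assms, of "{}"] by simp

lemma number_lattice_subset_vecs_on:
  assumes "number_lattice X L"
  shows "L \<subseteq> vecs_on X"
proof -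
  obtain B where B: "set B \<subseteq> vecs_on X" "L = int_span B"
    using assms by (auto simp: number_lattice_def)
  have "(\<Sum>i<length B. vscale (rat_of_int (c i)) (B ! i)) \<in> vecs_on X" for c
    using B by (intro qv.subspace_sum qv.subspace_scale subspace_vecs_on) auto
  then show ?thesis using B by (auto simp: int_span_def)
qed

lemma nth_in_int_span:
  assumes "i < length B"
  shows "B ! i \<in> int_span B"
proof -
  have "B ! i = (\<Sum>j<length B. vscale (rat_of_int (if j = i then 1 else 0)) (B ! j))"
    using assms by (subst sum.remove[of _ i]) auto
  then show ?thesis by (rule int_spanI)
qed

lemma int_span_subset_span: "int_span B \<subseteq> qv.span (set B)"
  unfolding int_span_def by clarify (intro qv.span_sum qv.span_scale qv.span_base, auto)

section \<open>Comparing two sorted lists by counting\<close>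

text \<open>At least \<open>Suc i\<close> of the \<open>f\<close>-values are at most
  \<open>a ! i\<close>, so at least \<open>Suc i\<close> of the \<open>g\<close>-values are at most
  \<open>K * a ! i\<close>. If \<open>b ! i\<close> exceeded this bound, only entries of
  \<open>b\<close> before position \<open>i\<close> could meet it. The two sortings may permute
  \<open>xs\<close> differently.\<close>

lemma sorted_image_le:
  fixes f g :: "'b \<Rightarrow> real"
  assumes a: "sorted a" "mset a = mset (map f xs)"
    and b: "sorted b" "mset b = mset (map g xs)"
    and le: "\<And>x. x \<in> set xs \<Longrightarrow> g x \<le> K * f x" and "0 \<le> K" and i: "i < length xs"
  shows "b ! i \<le> K * a ! i"
proof (rule ccontr)
  assume neg: "\<not> b ! i \<le> K * a ! i"
  have la: "length a = length xs" and lb: "length b = length xs"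
    using a b by (metis length_map size_mset)+
  have "Suc i = card {..i}" by simp
  also have "\<dots> \<le> card {j. j < length a \<and> a ! j \<le> a ! i}"
    using a i la by (intro card_mono) (auto intro: sorted_nth_mono)
  also have "\<dots> = size (filter_mset (\<lambda>v. v \<le> a ! i) (mset a))"
    by (simp add: length_filter_conv_card flip: mset_filter)
  also have "\<dots> = length (filter (\<lambda>x. f x \<le> a ! i) xs)"
    by (simp add: a filter_mset_image_mset flip: mset_filter)
  also have "\<dots> \<le> length (filter (\<lambda>x. g x \<le> K * a ! i) xs)"
  proof -
    have "g x \<le> K * a ! i" if "x \<in> set xs" "f x \<le> a ! i" for x
      using le[OF that(1)] mult_left_mono[OF that(2) \<open>0 \<le> K\<close>] by simp
    then have "filter (\<lambda>x. f x \<le> a ! i) xs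
        = filter (\<lambda>x. f x \<le> a ! i) (filter (\<lambda>x. g x \<le> K * a ! i) xs)"
      by (auto intro!: filter_cong)
    then show ?thesis by (metis length_filter_le)
  qed
  also have "\<dots> = size (filter_mset (\<lambda>v. v \<le> K * a ! i) (mset b))"
    by (simp add: b filter_mset_image_mset flip: mset_filter)
  also have "\<dots> = card {j. j < length b \<and> b ! j \<le> K * a ! i}"
    by (simp add: length_filter_conv_card flip: mset_filter)
  also have "\<dots> \<le> card {..<i}"
  proof (intro card_mono subsetI)
    fix j assume "j \<in> {j. j < length b \<and> b ! j \<le> K * a ! i}"
    then show "j \<in> {..<i}"
      using neg sorted_nth_mono[OF b(1), of i j] by (cases "j < i") auto
  qed simp
  finally show False by simp
qed

section \<open>Matched lattices\<close>

lemma regular_space_vector_space_on: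
  assumes "regular_space X V"
  shows "vector_space_on X V"
proof -
  obtain A where "set A \<subseteq> vecs_on X" "V = qv.span (set A)"
    using assms by (auto simp: regular_space_def)
  then show ?thesis
    using qv.span_minimal[OF _ subspace_vecs_on, of "set A" X] qv.subspace_span[of "set A"]
    by (simp add: vector_space_on_def)
qed

lemma vector_space_on_contraction:
  assumes "vector_space_on X V"
  shows "vector_space_on S (contraction V S)"
proof -
  have "contraction V S = vecs_on S \<inter> V"
    by (auto simp: contraction_def vjoin_eq_plus)
  then show ?thesis
    using assms qv.subspace_inter[OF subspace_vecs_on, of V S] by (simp add: vector_space_on_def)
qed

text \<open>The unimodular basis lets the values of \<open>y\<close> on \<open>P\<close> alone
  determine an extension. Each of its coordinates on \<open>S\<close> contributes at most
  \<open>card P\<close> times the squared norm of \<open>y\<close>, and there are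
  \<open>card S\<close> of them. The given \<open>x\<close> certifies that \<open>y\<close> is the
  \<open>P\<close>-part of a vector of \<open>V\<close>, as the representation requires.\<close>

lemma regular_space_extension_bound:
  assumes fin: "finite S" "finite P" and disj: "S \<inter> P = {}" and reg: "regular_space (S \<union> P) V"
    and x: "x \<in> vecs_on S" and y: "y \<in> vecs_on P" and xy: "vjoin x y \<in> V"
  obtains z where "z \<in> vecs_on S" "vjoin z y \<in> V"
    "vdot S z z \<le> of_nat (card S * card P) * vdot P y y"
proof -
  obtain cs r where cs: "distinct cs" "set cs \<subseteq> P"
    and rV: "\<And>a. a < length cs \<Longrightarrow> r a \<in> V"
    and r: "\<And>a e. a < length cs \<Longrightarrow> r a e \<in> {0, 1, -1}"
    and rep: "\<And>x e. x \<in> V \<Longrightarrow> e \<in> P \<Longrightarrow> x e = (\<Sum>a<length cs. x (cs ! a) * r a e)"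
    using regular_space_unimodular_basis[OF reg fin(2)] by blast
  have V: "V \<subseteq> vecs_on (S \<union> P)" "qv.subspace V"
    using regular_space_vector_space_on[OF reg] by (auto simp: vector_space_on_def)
  define w where "w = (\<Sum>a<length cs. vscale (y (cs ! a)) (r a))"
  have w_apply: "w e = (\<Sum>a<length cs. y (cs ! a) * r a e)" for e
    by (simp add: w_def sum_fun_apply vscale_def)
  have wV: "w \<in> V"
    unfolding w_def using V rV by (intro qv.subspace_sum qv.subspace_scale) auto
  have joinP: "vjoin x y e = y e" if "e \<in> P" for e
    using that x disj by (auto simp: vjoin_def vecs_on_def)
  have wP: "w e = y e" if "e \<in> P" for e
  proof -
    have "y e = (\<Sum>a<length cs. vjoin x y (cs ! a) * r a e)"
      using rep[OF xy that] joinP[OF that] by simp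
    also have "\<dots> = w e"
      unfolding w_apply using cs(2) by (intro sum.cong refl) (simp add: joinP subset_iff)
    finally show ?thesis ..
  qed
  \<comment> \<open>Since \<open>w\<close> agrees with \<open>y\<close> on \<open>P\<close>,
    subtracting \<open>y\<close> leaves exactly the \<open>S\<close>-part of
    \<open>w\<close>.\<close>
  define z where "z = w - y"
  have z: "z \<in> vecs_on S"
    using wP wV V(1) y by (force simp: z_def vecs_on_def)
  moreover have "vjoin z y \<in> V"
    using wV by (simp add: z_def vjoin_eq_plus)
  moreover have "vdot S z z \<le> of_nat (card S * card P) * vdot P y y"
  proof -
    have "(z e)\<^sup>2 \<le> of_nat (card P) * vdot P y y" if "e \<in> S" for e
    proof -
      have "z e = (\<Sum>a<length cs. y (cs ! a) * r a e)"
        using that y disj by (auto simp: z_def w_apply vecs_on_def)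
      then have "(z e)\<^sup>2 \<le> (\<Sum>a<length cs. (y (cs ! a))\<^sup>2) * (\<Sum>a<length cs. (r a e)\<^sup>2)"
        by (simp add: Cauchy_Schwarz_ineq_sum)
      also have "(\<Sum>a<length cs. (y (cs ! a))\<^sup>2) = (\<Sum>q\<in>set cs. (y q)\<^sup>2)"
        using sum.reindex_bij_betw[OF bij_betw_nth[OF cs(1) refl refl], of "\<lambda>q. (y q)\<^sup>2"] .
      also have "\<dots> * (\<Sum>a<length cs. (r a e)\<^sup>2) \<le> vdot P y y * of_nat (card P)"
      proof (intro mult_mono)
        show "(\<Sum>q\<in>set cs. (y q)\<^sup>2) \<le> vdot P y y"
          unfolding vdot_def power2_eq_square using fin cs by (intro sum_mono2) auto
        have "(\<Sum>a<length cs. (r a e)\<^sup>2) \<le> (\<Sum>a<length cs. 1)"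
          using r[of _ e] by (intro sum_mono) fastforce
        also have "\<dots> \<le> rat_of_nat (card P)"
          using card_mono[OF fin(2) cs(2)] distinct_card[OF cs(1)] by simp
        finally show "(\<Sum>a<length cs. (r a e)\<^sup>2) \<le> of_nat (card P)" .
      qed (auto intro: sum_nonneg vdot_self_nonneg)
      finally show ?thesis by (simp add: mult.commute)
    qed
    then have "vdot S z z \<le> (\<Sum>e\<in>S. of_nat (card P) * vdot P y y)"
      unfolding vdot_def[of S] power2_eq_square by (intro sum_mono) auto
    then show ?thesis by simp
  qed
  ultimately show ?thesis by (rule that)
qed

text \<open>
  The assumptions are symmetric under exchanging \<open>(S, LS)\<close> and \<open>(P, LP)\<close>, so every result below
  is available in both directions through \<open>swap\<close>.
\<close>

locale matched_lattices =
  fixes S P :: "'a set" and V LS LP :: "('a \<Rightarrow> rat) set"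
  assumes finite_S: "finite S" and finite_P: "finite P" and disjoint: "S \<inter> P = {}"
    and regular: "regular_space (S \<union> P) V"
    and lattice_S: "number_lattice S LS" and lattice_P: "number_lattice P LP"
    and orth_S: "orthogonal_on S LS (contraction V S)"
    and orth_P: "orthogonal_on P LP (contraction V P)"
    and ex_match_P: "\<And>x. x \<in> LS \<Longrightarrow> \<exists>y\<in>LP. vjoin x y \<in> V"
    and ex_match_S: "\<And>y. y \<in> LP \<Longrightarrow> \<exists>x\<in>LS. vjoin x y \<in> V"
begin

lemma swap: "matched_lattices P S V LP LS"
  using matched_lattices_axioms
  by (simp add: matched_lattices_def Un_commute Int_commute vjoin_eq_plus add.commute)

lemma subspace_V: "qv.subspace V"
  using regular_space_vector_space_on[OF regular] by (simp add: vector_space_on_def)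

lemma LS_subset: "LS \<subseteq> vecs_on S"
  by (rule number_lattice_subset_vecs_on[OF lattice_S])

lemma LP_subset: "LP \<subseteq> vecs_on P"
  by (rule number_lattice_subset_vecs_on[OF lattice_P])

abbreviation "factor \<equiv> sqrt (real (card S) * real (card P))"

text \<open>Orthogonality to the contraction makes \<open>x\<close> the shortest vector matching \<open>y\<close>.\<close>

lemma vnorm_match_le:
  assumes x: "x \<in> LS" and y: "y \<in> LP" and xy: "vjoin x y \<in> V"
  shows "vnorm S x \<le> factor * vnorm P y"
proof -
  have xv: "x \<in> vecs_on S" and yv: "y \<in> vecs_on P"
    using x y LS_subset LP_subset by auto
  obtain z where z: "z \<in> vecs_on S" "vjoin z y \<in> V"
    "vdot S z z \<le> of_nat (card S * card P) * vdot P y y"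
    using regular_space_extension_bound[OF finite_S finite_P disjoint regular xv yv xy] .
  \<comment> \<open>Two extensions of the same \<open>y\<close> differ by an element of the
    contraction, to which \<open>x\<close> is orthogonal; Pythagoras then compares \<open>x\<close>
    with the short extension \<open>z\<close>.\<close>
  have "vjoin z y - vjoin x y \<in> V"
    using subspace_V z(2) xy by (rule qv.subspace_diff)
  then have "z - x \<in> contraction V S"
    using qv.subspace_diff[OF subspace_vecs_on z(1) xv]
    by (simp add: contraction_def vjoin_eq_plus)
  then have "vdot S x (z - x) = 0"
    using orth_S x by (auto simp: orthogonal_on_def)
  then have "vdot S (z - x) x = 0" by (simp add: vdot_commute)
  have "vdot S z z = vdot S (z - x) z + vdot S x z"
    using vdot_diff_left[of S z x z] by simp
  also have "\<dots> = vdot S (z - x) (z - x) + vdot S (z - x) x + vdot S x x + vdot S x (z - x)"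
    using vdot_diff_left[of S z x "z - x"] vdot_diff_left[of S z x x] vdot_diff_left[of S z x z]
    by (simp add: vdot_commute)
  finally have "vdot S z z = vdot S (z - x) (z - x) + vdot S x x"
    using \<open>vdot S x (z - x) = 0\<close> \<open>vdot S (z - x) x = 0\<close> by simp
  then have "vdot S x x \<le> of_nat (card S * card P) * vdot P y y"
    using z(3) vdot_self_nonneg[of S "z - x"] by linarith
  then have "real_of_rat (vdot S x x) \<le> real_of_rat (of_nat (card S * card P) * vdot P y y)"
    by (simp only: of_rat_less_eq)
  then show ?thesis
    by (simp add: vnorm_eq of_rat_mult flip: real_sqrt_mult)
qed

text \<open>The difference of two partners lies in \<open>LS\<close> and in the contraction, hence
  is orthogonal to itself.\<close>

lemma match_unique:
  assumes "x \<in> LS" "x' \<in> LS" "vjoin x y \<in> V" "vjoin x' y \<in> V"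
  shows "x = x'"
proof -
  have d: "x - x' \<in> LS"
    using number_lattice_diff[OF lattice_S assms(1,2)] .
  have "vjoin x y - vjoin x' y \<in> V"
    using subspace_V assms by (intro qv.subspace_diff) auto
  then have "x - x' \<in> contraction V S"
    using d LS_subset by (auto simp: contraction_def vjoin_eq_plus)
  then have "vdot S (x - x') (x - x') = 0"
    using orth_S d unfolding orthogonal_on_def by blast
  then show ?thesis
    using vdot_self_eq_0_iff[OF finite_S] d LS_subset by fastforce
qed

lemma match_S_ex1: "y \<in> LP \<Longrightarrow> \<exists>!x. x \<in> LS \<and> vjoin x y \<in> V"
  using ex_match_S match_unique by blast

lemma partner_S: "y \<in> LP \<Longrightarrow> partner V LS y \<in> LS \<and> vjoin (partner V LS y) y \<in> V"
  unfolding partner_def by (rule theI'[OF match_S_ex1])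

lemma match_P_unique:
  assumes "y \<in> LP" "y' \<in> LP" "vjoin x y \<in> V" "vjoin x y' \<in> V"
  shows "y = y'"
  using matched_lattices.match_unique[OF swap, of y y' x] assms
  by (simp add: vjoin_eq_plus add.commute)

text \<open>If \<open>x\<close> were zero, both \<open>y\<close> and zero would be its partners in
  \<open>LP\<close>.\<close>

lemma match_S_nonzero:
  assumes "y \<in> LP" "y \<noteq> 0" "vjoin x y \<in> V"
  shows "x \<noteq> 0"
  using match_P_unique[of y 0 x] number_lattice_zero[OF lattice_P] assms qv.subspace_0[OF subspace_V]
  by (auto simp: vjoin_eq_plus)

lemma partner_inj_on: "inj_on (partner V LS) LP"
  using partner_S match_P_unique by (intro inj_onI) metis

text \<open>A vanishing combination of partners leaves the same combination \<open>?w\<close> of the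
  original vectors in the contraction to \<open>P\<close>. The coefficients are rational, so
  \<open>?w\<close> may lie outside \<open>LP\<close> and uniqueness of partners does not apply; but
  every term is orthogonal to the contraction, so \<open>?w\<close> is orthogonal to itself.\<close>

lemma independent_partner_image:
  assumes "B \<subseteq> LP" "qv.independent B"
  shows "qv.independent (partner V LS ` B)"
  unfolding qv.independent_explicit_module
proof (intro allI impI)
  fix t u v
  let ?T = "partner V LS"
  assume fin: "finite t" and sub: "t \<subseteq> ?T ` B" and zero: "(\<Sum>v\<in>t. vscale (u v) v) = 0" and v: "v \<in> t"
  obtain s where s: "s \<subseteq> B" "t = ?T ` s"
    using sub by (auto simp: subset_image_iff)
  have inj: "inj_on ?T s"
    using inj_on_subset[OF partner_inj_on] s assms by auto
  then have fs: "finite s"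
    using fin s by (simp add: finite_image_iff)
  have sLP: "b \<in> LP" if "b \<in> s" for b
    using that s assms by auto
  let ?w = "\<Sum>b\<in>s. vscale (u (?T b)) b"
  have "(\<Sum>b\<in>s. vscale (u (?T b)) (?T b)) = 0"
    using zero inj by (simp add: s sum.reindex)
  then have "?w = (\<Sum>b\<in>s. vscale (u (?T b)) (?T b + b))"
    by (simp add: qv.scale_right_distrib sum.distrib)
  also have "\<dots> \<in> V"
    using partner_S sLP subspace_V
    by (intro qv.subspace_sum qv.subspace_scale) (auto simp: vjoin_eq_plus)
  finally have "?w \<in> V" .
  moreover have wP: "?w \<in> vecs_on P"
    using sLP LP_subset by (intro qv.subspace_sum qv.subspace_scale subspace_vecs_on) auto
  ultimately have "?w \<in> contraction V P"
    by (simp add: contraction_def vjoin_eq_plus)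
  then have "vdot P b ?w = 0" if "b \<in> s" for b
    using orth_P sLP[OF that] unfolding orthogonal_on_def by blast
  then have "vdot P ?w ?w = 0"
    by (simp add: vdot_sum_left[of P _ s ?w] vdot_scale_left)
  then have "?w = 0"
    using vdot_self_eq_0_iff[OF finite_P wP] by simp
  moreover obtain b where "b \<in> s" "v = ?T b" using v s by auto
  ultimately show "u v = 0"
    using qv.independentD[OF assms(2) fs s(1), of "\<lambda>b. u (?T b)" b] by simp
qed

text \<open>For generation, the partner of \<open>x\<close> is expanded in \<open>B\<close>. The
  same integer combination of the partners of the rows matches that vector too, so it equals
  \<open>x\<close> by uniqueness.\<close>

lemma basis_matrix_partner:
  assumes B: "basis_matrix LP B"
  shows "basis_matrix LS (map (partner V LS) B)"
proof -
  let ?T = "partner V LS"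
  have LP: "LP = int_span B" and BLP: "set B \<subseteq> LP"
    using B nth_in_int_span[of _ B] by (auto simp: basis_matrix_def in_set_conv_nth)
  have "distinct (map ?T B)"
    using B inj_on_subset[OF partner_inj_on BLP] by (simp add: basis_matrix_def distinct_map)
  moreover have "qv.independent (set (map ?T B))"
    using B BLP independent_partner_image by (simp add: basis_matrix_def)
  moreover have in_LS: "(\<Sum>i<length B. vscale (rat_of_int (c i)) (map ?T B ! i)) \<in> LS" for c
    using BLP partner_S by (intro number_lattice_sum[OF lattice_S]) (auto simp: subset_iff)
  moreover have "LS \<subseteq> int_span (map ?T B)"
  proof
    fix x assume x: "x \<in> LS"
    then obtain y where y: "y \<in> LP" "vjoin x y \<in> V" using ex_match_P by blast
    then obtain c where c: "y = (\<Sum>i<length B. vscale (rat_of_int (c i)) (B ! i))"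
      by (auto simp: LP int_span_def)
    let ?x = "\<Sum>i<length B. vscale (rat_of_int (c i)) (map ?T B ! i)"
    have "vjoin ?x y = (\<Sum>i<length B. vscale (rat_of_int (c i)) (?T (B ! i) + B ! i))"
      by (simp add: c vjoin_eq_plus qv.scale_right_distrib sum.distrib)
    also have "\<dots> \<in> V"
      using partner_S BLP subspace_V
      by (intro qv.subspace_sum qv.subspace_scale) (auto simp: vjoin_eq_plus subset_iff)
    finally have "x = ?x"
      using match_unique[OF x in_LS y(2)] by blast
    then show "x \<in> int_span (map ?T B)"
      by (intro int_spanI[where c = c]) simp
  qed
  ultimately show ?thesis
    by (auto simp: basis_matrix_def int_span_def)
qed

text \<open>A basis chosen inside the ball of \<open>LP\<close> has independent partners inside the
  enlarged ball of \<open>LS\<close>.\<close>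

lemma dim_ball_le:
  "qv.dim (LP \<inter> {f. vnorm P f \<le> r}) \<le> qv.dim (LS \<inter> {f. vnorm S f \<le> factor * r})"
proof -
  obtain B where B: "B \<subseteq> LP \<inter> {f. vnorm P f \<le> r}" "qv.independent B"
    "card B = qv.dim (LP \<inter> {f. vnorm P f \<le> r})"
    using qv.basis_exists[of "LP \<inter> {f. vnorm P f \<le> r}"] by metis
  have "vnorm S (partner V LS b) \<le> factor * r" if "b \<in> B" for b
  proof -
    have "vnorm S (partner V LS b) \<le> factor * vnorm P b"
      using that B partner_S by (intro vnorm_match_le) auto
    also have "\<dots> \<le> factor * r"
      using that B by (intro mult_left_mono) auto
    finally show ?thesis .
  qed
  then have "partner V LS ` B \<subseteq> LS \<inter> {f. vnorm S f \<le> factor * r}"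
    using B partner_S by auto
  moreover have "card (partner V LS ` B) = card B"
    using B inj_on_subset[OF partner_inj_on] by (intro card_image) auto
  ultimately show ?thesis
    using card_independent_le_dim[OF finite_S, of "LS \<inter> {f. vnorm S f \<le> factor * r}" "partner V LS ` B"]
      independent_partner_image[of B] B LS_subset by auto
qed

end

section \<open>Successive minima and their behaviour under matching\<close>

text \<open>This bounds the radii in \<open>succ_min\<close> from below for every index
  \<open>Suc i\<close>. At index 0 every real radius would be admissible and the infimum would carry
  no information.\<close>

lemma dim_ball_pos_imp_nonneg:
  assumes "0 < qv.dim (L \<inter> {f. vnorm X f \<le> r})"
  shows "0 \<le> r"
proof -
  have "L \<inter> {f. vnorm X f \<le> r} \<noteq> {}"
    using assms qv.dim_eq_card_independent[OF qv.independent_empty] by (metis card.empty less_irrefl)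
  then obtain f where "vnorm X f \<le> r" by blast
  then show ?thesis using vnorm_nonneg[of X f] by linarith
qed

lemma succ_min_le:
  assumes "Suc i \<le> qv.dim (L \<inter> {f. vnorm X f \<le> r})"
  shows "succ_min X L (Suc i) \<le> r"
  unfolding succ_min_def
proof (rule cInf_lower)
  show "bdd_below {r. Suc i \<le> qv.dim (qv.span (L \<inter> {f. vnorm X f \<le> r}))}"
    by (rule bdd_belowI[of _ 0]) (auto intro: dim_ball_pos_imp_nonneg[of L X])
qed (use assms in simp)

lemma succ_min_nonneg:
  assumes "Suc i \<le> qv.dim (L \<inter> {f. vnorm X f \<le> r})"
  shows "0 \<le> succ_min X L (Suc i)"
  unfolding succ_min_def using assms
  by (intro cInf_greatest) (auto intro: dim_ball_pos_imp_nonneg[of L X])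

text \<open>The first \<open>Suc i\<close> rows are independent and none is longer than row
  \<open>i\<close>. Besides bounding \<open>succ_min\<close>, this shows that its set of radii is
  nonempty.\<close>

lemma ordered_basis_dim_ball:
  assumes X: "finite X" and L: "number_lattice X L" and B: "basis_matrix L B"
    and ord: "length_ordered X B" and i: "i < length B"
  shows "Suc i \<le> qv.dim (L \<inter> {f. vnorm X f \<le> vnorm X (B ! i)})"
proof -
  have "set (take (Suc i) B) \<subseteq> L \<inter> {f. vnorm X f \<le> vnorm X (B ! i)}"
  proof
    fix f assume "f \<in> set (take (Suc i) B)"
    then obtain j where j: "j \<le> i" "f = B ! j"
      using i by (auto simp: in_set_conv_nth less_Suc_eq_le)
    then have "vnorm X f \<le> vnorm X (B ! i)"
      using sorted_nth_mono[of "map (vnorm X) B" j i] ord i by (simp add: length_ordered_def)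
    then show "f \<in> L \<inter> {f. vnorm X f \<le> vnorm X (B ! i)}"
      using nth_in_int_span[of j B] j i B by (simp add: basis_matrix_def)
  qed
  moreover have "qv.independent (set (take (Suc i) B))"
    using B qv.independent_mono[OF _ set_take_subset, of B] by (metis basis_matrix_def)
  moreover have "card (set (take (Suc i) B)) = Suc i"
    using B i by (subst distinct_card) (auto simp: basis_matrix_def)
  ultimately show ?thesis
    using card_independent_le_dim[OF X, of "L \<inter> {f. vnorm X f \<le> vnorm X (B ! i)}" "set (take (Suc i) B)"]
      number_lattice_subset_vecs_on[OF L] by auto
qed

lemma basis_matrix_length:
  assumes "basis_matrix L B"
  shows "length B = qv.dim L"
proof -
  have "set B \<subseteq> L"
    using assms nth_in_int_span[of _ B] by (auto simp: basis_matrix_def in_set_conv_nth)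
  then show ?thesis
    using assms qv.basis_card_eq_dim[of "set B" L] int_span_subset_span[of B]
    by (auto simp: basis_matrix_def distinct_card)
qed

text \<open>Each radius \<open>t\<close> admissible for \<open>LP\<close> yields
  \<open>factor * t\<close> for \<open>LS\<close>, and the infimum is taken over \<open>t\<close>.
  The assumption supplies one admissible radius.\<close>

lemma (in matched_lattices) succ_min_match_le:
  assumes "Suc i \<le> qv.dim (LP \<inter> {f. vnorm P f \<le> r})"
  shows "succ_min S LS (Suc i) \<le> factor * succ_min P LP (Suc i)"
proof -
  have le: "succ_min S LS (Suc i) \<le> factor * t" if "Suc i \<le> qv.dim (LP \<inter> {f. vnorm P f \<le> t})" for t
    using dim_ball_le[of t] that by (intro succ_min_le) auto
  show ?thesis
  \<comment> \<open>Taking the infimum requires dividing by \<open>factor\<close>. If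
    \<open>factor\<close> vanishes, the single given radius already gives the bound 0.\<close>
  proof (cases "factor = 0")
    case True
    then show ?thesis using le[OF assms] by (simp only: mult_zero_left)
  next
    case False
    moreover have "0 \<le> factor" by (intro real_sqrt_ge_zero) simp
    ultimately have pos: "0 < factor" by linarith
    have "succ_min S LS (Suc i) / factor \<le> succ_min P LP (Suc i)"
      unfolding succ_min_def[of P]
      using assms le
      by (intro cInf_greatest) (auto simp: pos_divide_le_eq[OF pos] mult.commute[of _ factor])
    then show ?thesis by (simp only: pos_divide_le_eq[OF pos] mult.commute[of _ factor])
  qed
qed

context matched_lattices
begin

lemma factor_nonneg: "0 \<le> factor"
  by (intro real_sqrt_ge_zero) simp

lemma factor_swap: "sqrt (real (card P) * real (card S)) = factor"
  by (simp add: mult.commute)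

lemma vjoin_swap: "vjoin x y \<in> V \<longleftrightarrow> vjoin y x \<in> V"
  by (simp add: vjoin_eq_plus add.commute)

lemma vnorm_match_ge:
  assumes "x \<in> LS" "y \<in> LP" "vjoin x y \<in> V"
  shows "vnorm P y \<le> factor * vnorm S x"
  using matched_lattices.vnorm_match_le[OF swap, of y x] assms vjoin_swap
  unfolding factor_swap by blast

text \<open>In the exchanged roles an admissible radius for \<open>LS\<close> is required; it is
  obtained by transporting the ball spanned by the first rows of \<open>B\<close>.\<close>

lemma succ_min_match_ge:
  assumes "basis_matrix LP B" "length_ordered P B" "i < length B"
  shows "succ_min P LP (Suc i) \<le> factor * succ_min S LS (Suc i)"
  using matched_lattices.succ_min_match_le[OF swap]
    order_trans[OF ordered_basis_dim_ball[OF finite_P lattice_P assms] dim_ball_le]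
  unfolding factor_swap by blast

lemma basis_row_pos:
  assumes B: "basis_matrix LP B" and i: "i < length B"
  shows "0 < vnorm P (B ! i)"
proof -
  have "B ! i \<noteq> 0"
    using B i qv.dependent_zero[of "set B"] by (metis basis_matrix_def nth_mem)
  moreover have "B ! i \<in> vecs_on P"
    using B nth_in_int_span[OF i] LP_subset by (auto simp: basis_matrix_def)
  ultimately show ?thesis
    using vnorm_eq_0_iff[OF finite_P, of "B ! i"] vnorm_nonneg[of P "B ! i"] by linarith
qed

text \<open>A row of \<open>B\<close> is nonzero, yet its length is at most \<open>factor\<close>
  times that of its partner. This legitimates the divisions by \<open>factor\<close>, which
  otherwise would take the default value 0.\<close>

lemma factor_pos:
  assumes B: "basis_matrix LP B" and i: "i < length B"
  shows "0 < factor"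
proof -
  have "B ! i \<in> LP" using B nth_in_int_span[OF i] by (simp add: basis_matrix_def)
  then have "vnorm P (B ! i) \<le> factor * vnorm S (partner V LS (B ! i))"
    using partner_S by (intro vnorm_match_ge) auto
  then have "factor \<noteq> 0"
    using basis_row_pos[OF B i] by (metis mult_zero_left not_less)
  then show ?thesis using factor_nonneg by linarith
qed

text \<open>Row-by-row bounds hold only between partners, while the two sortings may pair other
  rows; \<open>sorted_image_le\<close> in both directions bridges this.\<close>

lemma ordered_rows_bounds:
  assumes B: "basis_matrix LP BP"
    and P': "mset BP' = mset BP" "length_ordered P BP'"
    and S'': "mset BS'' = mset (map (partner V LS) BP)" "length_ordered S BS''"
    and i: "i < length BP"
  shows "1 / factor * vnorm P (BP' ! i) \<le> vnorm S (BS'' ! i) \<and>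
    vnorm S (BS'' ! i) \<le> factor * vnorm P (BP' ! i)"
proof
  have len: "length BP' = length BP" "length BS'' = length BP"
    using mset_eq_length[OF P'(1)] mset_eq_length[OF S''(1)] by auto
  have BLP: "x \<in> LP" if "x \<in> set BP" for x
    using B that nth_in_int_span[of _ BP] by (auto simp: basis_matrix_def in_set_conv_nth)
  let ?f = "vnorm P" and ?g = "\<lambda>x. vnorm S (partner V LS x)"
  have a: "sorted (map ?f BP')" "mset (map ?f BP') = mset (map ?f BP)"
    using P' by (simp_all add: length_ordered_def)
  have b: "sorted (map (vnorm S) BS'')" "mset (map (vnorm S) BS'') = mset (map ?g BP)"
    using S'' by (simp_all add: length_ordered_def image_mset.compositionality comp_def)
  have "map (vnorm S) BS'' ! i \<le> factor * map ?f BP' ! i"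
    by (rule sorted_image_le[OF a b _ factor_nonneg i]) (use partner_S BLP vnorm_match_le in blast)
  then show "vnorm S (BS'' ! i) \<le> factor * vnorm P (BP' ! i)"
    using len i by simp
  have "map ?f BP' ! i \<le> factor * map (vnorm S) BS'' ! i"
    by (rule sorted_image_le[OF b a _ factor_nonneg i]) (use partner_S BLP vnorm_match_ge in blast)
  then have "vnorm P (BP' ! i) \<le> factor * vnorm S (BS'' ! i)"
    using len i by simp
  then show "1 / factor * vnorm P (BP' ! i) \<le> vnorm S (BS'' ! i)"
    by (simp only: times_divide_eq_left mult_1 pos_divide_le_eq[OF factor_pos[OF B i]]
        mult.commute[of _ factor])
qed

text \<open>The sign of \<open>\<alpha> ! i\<close> is forced: a positive row length is bounded by
  it times a nonnegative successive minimum.\<close>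

lemma SM_factor_pos:
  assumes SM: "SM_basis_matrix P \<alpha> LP BP" and ord: "length_ordered P BP" and i: "i < length BP"
  shows "0 < \<alpha> ! i"
proof (rule ccontr)
  have BP: "basis_matrix LP BP" using SM by (simp add: SM_basis_matrix_def)
  assume "\<not> 0 < \<alpha> ! i"
  moreover have "0 \<le> succ_min P LP (Suc i)"
    using ordered_basis_dim_ball[OF finite_P lattice_P BP ord i] by (rule succ_min_nonneg)
  ultimately have "\<alpha> ! i * succ_min P LP (Suc i) \<le> 0"
    by (intro mult_nonpos_nonneg) auto
  moreover have "vnorm P (BP ! i) \<le> \<alpha> ! i * succ_min P LP (Suc i)"
    using SM i by (simp add: SM_basis_matrix_def)
  ultimately show False using basis_row_pos[OF BP i] by linarith
qed

lemma length_basis_eq: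
  assumes "basis_matrix LP BP" "basis_matrix LS BS"
  shows "length BS = length BP"
  using basis_matrix_length[OF assms(2)] basis_matrix_length[OF basis_matrix_partner[OF assms(1)]]
  by simp

text \<open>\<open>BS\<close> is unrelated to \<open>BP\<close>, so the comparison passes through
  the successive minima: row \<open>i\<close> of \<open>BP\<close> against that of
  \<open>LP\<close>, this against that of \<open>LS\<close>, and this against row \<open>i\<close>
  of \<open>BS\<close>.\<close>

lemma SM_basis_lower_bound:
  assumes SM: "SM_basis_matrix P \<alpha> LP BP" and ordP: "length_ordered P BP"
    and BS: "basis_matrix LS BS" and ordS: "length_ordered S BS" and i: "i < length BP"
  shows "1 / (\<alpha> ! i * factor) * vnorm P (BP ! i) \<le> vnorm S (BS ! i)"
proof -
  have BP: "basis_matrix LP BP" using SM by (simp add: SM_basis_matrix_def)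
  have \<alpha>: "0 < \<alpha> ! i" using SM_factor_pos[OF SM ordP i] .
  have iS: "i < length BS" using i length_basis_eq[OF BP BS] by simp
  have "succ_min P LP (Suc i) \<le> factor * succ_min S LS (Suc i)"
    using succ_min_match_ge[OF BP ordP i] .
  also have "\<dots> \<le> factor * vnorm S (BS ! i)"
    using succ_min_le[OF ordered_basis_dim_ball[OF finite_S lattice_S BS ordS iS]] factor_nonneg
    by (rule mult_left_mono)
  finally have "\<alpha> ! i * succ_min P LP (Suc i) \<le> \<alpha> ! i * (factor * vnorm S (BS ! i))"
    using \<alpha> by (intro mult_left_mono) auto
  moreover have "vnorm P (BP ! i) \<le> \<alpha> ! i * succ_min P LP (Suc i)"
    using SM i by (simp add: SM_basis_matrix_def)
  moreover have "\<alpha> ! i * (factor * vnorm S (BS ! i)) = vnorm S (BS ! i) * (\<alpha> ! i * factor)"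
    by (simp only: mult_ac)
  ultimately have "vnorm P (BP ! i) \<le> vnorm S (BS ! i) * (\<alpha> ! i * factor)"
    by linarith
  moreover have "0 < \<alpha> ! i * factor"
    using \<alpha> factor_pos[OF BP i] by (rule mult_pos_pos)
  ultimately show ?thesis
    by (simp only: times_divide_eq_left mult_1 pos_divide_le_eq)
qed

text \<open>\<open>factor\<close> enters twice, once from a row to its partner and once between the
  successive minima, which gives the product of the two cardinalities. The partners keep the order
  of \<open>BP\<close> and may fail to be sorted by length.\<close>

lemma SM_basis_matrix_partner:
  assumes SM: "SM_basis_matrix P \<alpha> LP BP" and ord: "length_ordered P BP"
  shows "SM_basis_matrix S (map (\<lambda>a. a * real (card S) * real (card P)) \<alpha>) LS
    (map (partner V LS) BP)"
proof -
  have BP: "basis_matrix LP BP" and len: "length \<alpha> = length BP"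
    using SM by (simp_all add: SM_basis_matrix_def)
  have "vnorm S (partner V LS (BP ! i))
      \<le> \<alpha> ! i * real (card S) * real (card P) * succ_min S LS (Suc i)" if i: "i < length BP" for i
  proof -
    have "BP ! i \<in> LP" using BP nth_in_int_span[OF i] by (simp add: basis_matrix_def)
    then have "vnorm S (partner V LS (BP ! i)) \<le> factor * vnorm P (BP ! i)"
      using partner_S by (intro vnorm_match_le) auto
    also have "\<dots> \<le> factor * (\<alpha> ! i * succ_min P LP (Suc i))"
      using SM i factor_nonneg by (intro mult_left_mono) (auto simp: SM_basis_matrix_def)
    also have "\<dots> \<le> factor * (\<alpha> ! i * (factor * succ_min S LS (Suc i)))"
      using succ_min_match_ge[OF BP ord i] factor_nonneg SM_factor_pos[OF SM ord i]
      by (intro mult_left_mono) auto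
    also have "\<dots> = \<alpha> ! i * (factor * factor) * succ_min S LS (Suc i)"
      by (simp only: mult_ac)
    also have "factor * factor = real (card S) * real (card P)"
      by simp
    finally show ?thesis by (simp only: mult.assoc)
  qed
  then show ?thesis
    unfolding SM_basis_matrix_def using basis_matrix_partner[OF BP] len by simp
qed

end

section \<open>Construction of the matched lattice\<close>

text \<open>Each generator of \<open>LP\<close> is extended to \<open>S\<close>, and the extension
  is made orthogonal to the contraction by subtracting its projection. This keeps it matched,
  because elements of the contraction lie in \<open>V\<close> with zero
  \<open>P\<close>-part.\<close>

lemma number_lattice_image_exists:
  assumes fin: "finite S" and V: "vector_space_on (S \<union> P) V"
    and LP: "number_lattice P LP" and ext: "\<And>y. y \<in> LP \<Longrightarrow> \<exists>x \<in> vecs_on S. vjoin x y \<in> V"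
    and K: "K = matched_comp V S (contraction V P + LP)"
  shows "\<exists>LS. number_lattice S LS \<and> orthogonal_on S LS (contraction V S) \<and> K = contraction V S + LS"
proof -
  let ?VS = "contraction V S"
  have subV: "qv.subspace V" using V by (simp add: vector_space_on_def)
  have VS: "vector_space_on S ?VS"
    using vector_space_on_contraction[OF V] .
  obtain B where B: "set B \<subseteq> vecs_on P" "LP = int_span B"
    using LP by (auto simp: number_lattice_def)
  have "\<exists>x. x \<in> vecs_on S \<and> vjoin x b \<in> V \<and> (\<forall>v\<in>?VS. vdot S x v = 0)" if b: "b \<in> LP" for b
  proof -
    obtain x where x: "x \<in> vecs_on S" "vjoin x b \<in> V" using ext[OF b] by blast
    obtain w where w: "w \<in> ?VS" "\<forall>v\<in>?VS. vdot S (x - w) v = 0"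
      using orthogonal_projection[OF fin VS x(1)] by blast
    then have "w \<in> vecs_on S" "w \<in> V" by (auto simp: contraction_def vjoin_eq_plus)
    then have "x - w \<in> vecs_on S" "(x + b) - w \<in> V"
      using x subV by (auto simp only: vjoin_eq_plus intro: qv.subspace_diff subspace_vecs_on)
    moreover have "(x + b) - w = vjoin (x - w) b" by (simp add: vjoin_eq_plus)
    ultimately show ?thesis using w(2) by (intro exI[of _ "x - w"] conjI) (simp_all only:)
  qed
  then obtain T where T: "\<And>b. b \<in> LP \<Longrightarrow> T b \<in> vecs_on S" "\<And>b. b \<in> LP \<Longrightarrow> vjoin (T b) b \<in> V"
    "\<And>b v. b \<in> LP \<Longrightarrow> v \<in> ?VS \<Longrightarrow> vdot S (T b) v = 0"
    by metis
  \<comment> \<open>Generating \<open>LS\<close> by the images of the generators makes it a number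
    lattice at once; integer combinations then carry matching over to all of
    \<open>LP\<close>.\<close>
  define LS where "LS = int_span (map T B)"
  define comb where "comb c C = (\<Sum>i<length B. vscale (rat_of_int (c i)) (C ! i))"
    for c and C :: "('a \<Rightarrow> rat) list"
  have LS_iff: "x \<in> LS \<longleftrightarrow> (\<exists>c. x = comb c (map T B))" for x
    by (auto simp: LS_def int_span_def comb_def)
  have LP_iff: "y \<in> LP \<longleftrightarrow> (\<exists>c. y = comb c B)" for y
    by (auto simp: B(2) int_span_def comb_def)
  have BLP: "B ! i \<in> LP" if "i < length B" for i
    using nth_in_int_span[OF that] B by simp
  have comb_V: "comb c (map T B) + comb c B \<in> V" for c
  proof -
    have "comb c (map T B) + comb c B = (\<Sum>i<length B. vscale (rat_of_int (c i)) (T (B ! i) + B ! i))"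
      by (simp add: comb_def qv.scale_right_distrib sum.distrib)
    also have "\<dots> \<in> V"
      using T(2)[OF BLP] subV by (intro qv.subspace_sum qv.subspace_scale) (auto simp: vjoin_eq_plus)
    finally show ?thesis .
  qed
  have lat: "number_lattice S LS"
    unfolding number_lattice_def LS_def
    using T(1)[OF BLP] by (intro exI[of _ "map T B"] conjI refl) (auto simp: in_set_conv_nth)
  have orth: "orthogonal_on S LS ?VS"
    using T(3)[OF BLP]
    by (auto simp: orthogonal_on_def LS_iff comb_def vdot_sum_left vdot_scale_left)
  have "x \<in> K \<longleftrightarrow> x \<in> ?VS + LS" for x
  proof
    assume "x \<in> K"
    then obtain v y where x: "x \<in> vecs_on S" and v: "v \<in> contraction V P" and y: "y \<in> LP"
      and "vjoin x (v + y) \<in> V"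
      unfolding K by (auto simp: matched_comp_def elim!: set_plus_elim)
    then have V1: "x + (v + y) \<in> V" "v \<in> V" by (auto simp: vjoin_eq_plus contraction_def)
    obtain c where c: "y = comb c B" using y LP_iff by blast
    let ?x = "comb c (map T B)"
    have xLS: "?x \<in> LS" using LS_iff by blast
    \<comment> \<open>Removing \<open>v\<close> leaves \<open>x\<close> matched with
      \<open>y\<close>. So \<open>x\<close> and \<open>?x\<close> extend the same vector and differ
      by an element of \<open>?VS\<close>.\<close>
    have "(x + (v + y)) - v - (?x + y) \<in> V"
      using V1 comb_V[of c] c subV by (metis qv.subspace_diff)
    moreover have "(x + (v + y)) - v - (?x + y) = x - ?x" by simp
    ultimately have "x - ?x \<in> V" by metis
    moreover have "x - ?x \<in> vecs_on S"
      using x number_lattice_subset_vecs_on[OF lat] xLS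
      by (intro qv.subspace_diff[OF subspace_vecs_on]) auto
    ultimately have "x - ?x \<in> ?VS"
      by (simp add: contraction_def vjoin_eq_plus)
    then show "x \<in> ?VS + LS"
      using set_plus_intro[OF _ xLS, of "x - ?x" ?VS] by simp
  next
    assume "x \<in> ?VS + LS"
    then obtain v l where x: "x = v + l" "v \<in> ?VS" "l \<in> LS"
      by (auto elim!: set_plus_elim)
    then obtain c where c: "l = comb c (map T B)" using LS_iff by blast
    have v: "v \<in> vecs_on S" "v \<in> V" using x by (auto simp: contraction_def vjoin_eq_plus)
    have "x \<in> vecs_on S"
      unfolding x(1) using v number_lattice_subset_vecs_on[OF lat] x(3)
      by (intro qv.subspace_add[OF subspace_vecs_on]) auto
    moreover have "v + (l + comb c B) \<in> V"
      using v(2) comb_V[of c] subV c by (metis qv.subspace_add)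
    \<comment> \<open>The summand 0 exhibits the partner as an element of
      \<open>contraction V P + LP\<close>.\<close>
    then have "vjoin x (0 + comb c B) \<in> V"
      by (simp add: x(1) vjoin_eq_plus add.assoc)
    moreover have "0 \<in> contraction V P"
      using vector_space_on_contraction[OF V, of P] qv.subspace_0 by (auto simp: vector_space_on_def)
    moreover have "comb c B \<in> LP" using LP_iff by blast
    ultimately show "x \<in> K"
      unfolding K matched_comp_def by (intro CollectI conjI bexI[of _ "0 + comb c B"] set_plus_intro)
  qed
  then show ?thesis using lat orth by blast
qed

section \<open>The five statements for an arbitrary decomposition of \<open>KS\<close>\<close>

theorem theorem9:
  fixes S P :: "'a set"
    and VSP VP VS KP LP KS :: "('a \<Rightarrow> rat) set"
  assumes "finite S" and "finite P" and "S \<inter> P = {}"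
    and "regular_space (S \<union> P) VSP"
    and "VP = contraction VSP P"
    and "VS = contraction VSP S"
    and "generalized_number_lattice P KP"
    and "KP \<subseteq> restriction VSP S P"
    and "number_lattice P LP" and "orthogonal_on P LP VP" and "KP = VP + LP"
    and "KS = matched_comp VSP S KP"
  shows
    "(\<exists>LS. number_lattice S LS \<and> orthogonal_on S LS VS \<and> KS = VS + LS) \<and>
     (\<forall>LS. number_lattice S LS \<and> orthogonal_on S LS VS \<and> KS = VS + LS \<longrightarrow>
        \<comment> \<open>1, second part\<close>
        LS \<subseteq> matched_comp VSP S LP \<and> LP \<subseteq> matched_comp VSP P LS \<and>
        \<comment> \<open>2\<close>
        (\<forall>xP\<in>LP. xP \<noteq> 0 \<longrightarrow>
           (\<exists>!xS. xS \<in> LS \<and> vjoin xS xP \<in> VSP) \<and>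
           (\<forall>xS\<in>LS. vjoin xS xP \<in> VSP \<longrightarrow>
              xS \<noteq> 0 \<and> vnorm S xS \<le> sqrt (real (card S) * real (card P)) * vnorm P xP)) \<and>
        (\<forall>xS\<in>LS. xS \<noteq> 0 \<longrightarrow>
           (\<exists>!xP. xP \<in> LP \<and> vjoin xS xP \<in> VSP) \<and>
           (\<forall>xP\<in>LP. vjoin xS xP \<in> VSP \<longrightarrow>
              xP \<noteq> 0 \<and> vnorm P xP \<le> sqrt (real (card S) * real (card P)) * vnorm S xS)) \<and>
        \<comment> \<open>3\<close>
        (\<forall>BP BS. basis_matrix LP BP \<and> BS = map (partner VSP LS) BP \<longrightarrow>
           basis_matrix LS BS \<and>
           (\<forall>BP' BS''. mset BP' = mset BP \<and> length_ordered P BP' \<and>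
              mset BS'' = mset BS \<and> length_ordered S BS'' \<longrightarrow>
              (\<forall>i<length BP.
                 1 / sqrt (real (card S) * real (card P)) * vnorm P (BP' ! i) \<le> vnorm S (BS'' ! i) \<and>
                 vnorm S (BS'' ! i) \<le> sqrt (real (card S) * real (card P)) * vnorm P (BP' ! i)))) \<and>
        \<comment> \<open>4\<close>
        (\<forall>\<alpha> BP BS. SM_basis_matrix P \<alpha> LP BP \<and> length_ordered P BP \<and>
           basis_matrix LS BS \<and> length_ordered S BS \<longrightarrow>
           length BS = length BP \<and>
           (\<forall>i<length BP.
              1 / (\<alpha> ! i * sqrt (real (card S) * real (card P))) * vnorm P (BP ! i) \<le> vnorm S (BS ! i))) \<and>
        \<comment> \<open>5\<close>
        (\<forall>\<alpha> BP. SM_basis_matrix P \<alpha> LP BP \<and> length_ordered P BP \<longrightarrow>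
           SM_basis_matrix S (map (\<lambda>a. a * real (card S) * real (card P)) \<alpha>) LS
             (map (partner VSP LS) BP)))"
proof -
  have V: "vector_space_on (S \<union> P) VSP" and subV: "qv.subspace VSP"
    using regular_space_vector_space_on[OF assms(4)] by (auto simp: vector_space_on_def)
  have VS: "vector_space_on S VS" and VP: "vector_space_on P VP"
    using vector_space_on_contraction[OF V] assms(5,6) by auto
  have zeroS: "0 \<in> VS" and zeroP: "0 \<in> VP"
    using VS VP qv.subspace_0 by (auto simp: vector_space_on_def)
  have LP_KP: "LP \<subseteq> KP"
    using set_plus_intro[OF zeroP] \<open>KP = VP + LP\<close> by fastforce
  have ext: "\<exists>x \<in> vecs_on S. vjoin x y \<in> VSP" if "y \<in> LP" for y
    using that LP_KP assms(8) by (auto simp: restriction_def)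
  have exists: "\<exists>LS. number_lattice S LS \<and> orthogonal_on S LS VS \<and> KS = VS + LS"
    unfolding assms(6)
    by (rule number_lattice_image_exists[OF assms(1) V assms(9) ext])
      (use assms(5,11,12) in auto)
  \<comment> \<open>Any admissible \<open>LS\<close> fits the locale, not only the constructed one.
    Cases 9 and 10 are the existence of partners in either direction; an element of the
    corresponding contraction is subtracted to pass from \<open>KP\<close> to \<open>LP\<close> and
    from \<open>KS\<close> to \<open>LS\<close>.\<close>
  have matched: "matched_lattices S P VSP LS LP"
    if LS: "number_lattice S LS" "orthogonal_on S LS VS" "KS = VS + LS" for LS
  proof (unfold_locales, goal_cases)
    case (9 x)
    have "x \<in> KS"
      using set_plus_intro[OF zeroS 9] LS(3) by simp
    then obtain v y where v: "v \<in> VP" and y: "y \<in> LP" and "vjoin x (v + y) \<in> VSP"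
      unfolding assms(11,12) by (auto simp: matched_comp_def elim!: set_plus_elim)
    then have "x + (v + y) - v \<in> VSP"
      using subV unfolding vjoin_eq_plus assms(5) contraction_def
      by (intro qv.subspace_diff) auto
    then show ?case using y by (intro bexI[of _ y]) (simp_all add: vjoin_eq_plus)
  next
    case (10 y)
    obtain g where g: "g \<in> vecs_on S" "vjoin g y \<in> VSP" using ext[OF 10] by blast
    then have "g \<in> VS + LS"
      using 10 LP_KP LS(3) assms(12) by (auto simp: matched_comp_def)
    then obtain v x where v: "v \<in> VS" and x: "x \<in> LS" and gv: "g = v + x"
      by (auto elim!: set_plus_elim)
    have "g + y - v \<in> VSP"
      using subV g v unfolding vjoin_eq_plus assms(6) contraction_def
      by (intro qv.subspace_diff) auto
    then show ?case using x by (intro bexI[of _ x]) (simp_all add: vjoin_eq_plus gv)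
  qed (use assms LS in simp_all)
  show ?thesis
  proof (intro conjI[OF exists] allI impI)
    fix LS assume LS: "number_lattice S LS \<and> orthogonal_on S LS VS \<and> KS = VS + LS"
    then interpret M: matched_lattices S P VSP LS LP using matched by blast
    \<comment> \<open>The exchanged instance supplies the statements about partners in
      \<open>LP\<close>.\<close>
    interpret M': matched_lattices P S VSP LP LS by (rule M.swap)
    have subS: "LS \<subseteq> matched_comp VSP S LP"
      using M.ex_match_P M.LS_subset by (auto simp: matched_comp_def)
    have subP: "LP \<subseteq> matched_comp VSP P LS"
      using M.ex_match_S M.LP_subset M.vjoin_swap unfolding matched_comp_def by blast
    have ex1_P: "\<exists>!xP. xP \<in> LP \<and> vjoin xS xP \<in> VSP" if "xS \<in> LS" for xS
      using M'.match_S_ex1[OF that] M.vjoin_swap by metis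
    have nonzero_P: "xP \<noteq> 0" if "xS \<in> LS" "xS \<noteq> 0" "vjoin xS xP \<in> VSP" for xS xP
      using M'.match_S_nonzero that M.vjoin_swap by metis
    have len: "length BS = length BP"
      if "SM_basis_matrix P \<alpha> LP BP" "basis_matrix LS BS" for \<alpha> BP BS
      using that M.length_basis_eq by (simp add: SM_basis_matrix_def)
    show "LS \<subseteq> matched_comp VSP S LP \<and> LP \<subseteq> matched_comp VSP P LS \<and>
        (\<forall>xP\<in>LP. xP \<noteq> 0 \<longrightarrow>
           (\<exists>!xS. xS \<in> LS \<and> vjoin xS xP \<in> VSP) \<and>
           (\<forall>xS\<in>LS. vjoin xS xP \<in> VSP \<longrightarrow>
              xS \<noteq> 0 \<and> vnorm S xS \<le> sqrt (real (card S) * real (card P)) * vnorm P xP)) \<and>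
        (\<forall>xS\<in>LS. xS \<noteq> 0 \<longrightarrow>
           (\<exists>!xP. xP \<in> LP \<and> vjoin xS xP \<in> VSP) \<and>
           (\<forall>xP\<in>LP. vjoin xS xP \<in> VSP \<longrightarrow>
              xP \<noteq> 0 \<and> vnorm P xP \<le> sqrt (real (card S) * real (card P)) * vnorm S xS)) \<and>
        (\<forall>BP BS. basis_matrix LP BP \<and> BS = map (partner VSP LS) BP \<longrightarrow>
           basis_matrix LS BS \<and>
           (\<forall>BP' BS''. mset BP' = mset BP \<and> length_ordered P BP' \<and>
              mset BS'' = mset BS \<and> length_ordered S BS'' \<longrightarrow>
              (\<forall>i<length BP.
                 1 / sqrt (real (card S) * real (card P)) * vnorm P (BP' ! i) \<le> vnorm S (BS'' ! i) \<and>
                 vnorm S (BS'' ! i) \<le> sqrt (real (card S) * real (card P)) * vnorm P (BP' ! i)))) \<and>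
        (\<forall>\<alpha> BP BS. SM_basis_matrix P \<alpha> LP BP \<and> length_ordered P BP \<and>
           basis_matrix LS BS \<and> length_ordered S BS \<longrightarrow>
           length BS = length BP \<and>
           (\<forall>i<length BP.
              1 / (\<alpha> ! i * sqrt (real (card S) * real (card P))) * vnorm P (BP ! i) \<le> vnorm S (BS ! i))) \<and>
        (\<forall>\<alpha> BP. SM_basis_matrix P \<alpha> LP BP \<and> length_ordered P BP \<longrightarrow>
           SM_basis_matrix S (map (\<lambda>a. a * real (card S) * real (card P)) \<alpha>) LS
             (map (partner VSP LS) BP))"
    proof (intro conjI, goal_cases)
      case 3
      then show ?case using M.match_S_ex1 M.match_S_nonzero M.vnorm_match_le by blast
    next
      case 4
      then show ?case using ex1_P nonzero_P M.vnorm_match_ge by blast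
    next
      case 5
      then show ?case using M.basis_matrix_partner M.ordered_rows_bounds by metis
    next
      case 6
      then show ?case using len M.SM_basis_lower_bound by metis
    next
      case 7
      then show ?case using M.SM_basis_matrix_partner by metis
    qed (fact subS subP)+
  qed
qed

end
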